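(* Let $n\ge 2$ be an integer, let $J$ be a Jordan ring that is $2$-torsion free and $(n-1)$-torsion free, and let $e$ be a nontrivial idempotent in $J$. Let $J=J_1\oplus J_{\frac12}\oplus J_0$ be the Peirce decomposition of $J$ with respect to $e$. Suppose that $J$ satisfies the following conditions: (i) for $i\in\{1,0\}$ and $a_i\in J_i$: if $t_{\frac12}a_i=0$ for all $t_{\frac12}\in J_{\frac12}$, then $a_i=0$; (ii) for $a_0\in J_0$: if $t_0a_0=0$ for all $t_0\in J_0$, then $a_0=0$; (iii) for $a_{\frac12}\in J_{\frac12}$: if $t_0a_{\frac12}=0$ for all $t_0\in J_0$, then $a_{\frac12}=0$. Then every $n$-multiplicative derivation $d:J\to J$ is additive, i.e. $d(a+b)=d(a)+d(b)$ for all $a,b\in J$.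
   Context: Rings are not necessarily associative and not necessarily unital (an abelian group with a biadditive product). A ring $J$ is Jordan if $xy=yx$ and $(x^2y)x=x^2(yx)$ for all $x,y\in J$. For a positive integer $k$, $J$ is $k$-torsion free if $kx=0$ implies $x=0$ for $x\in J$. A nontrivial idempotent is a nonzero $e\in J$ with $e^2=e$ that is not the multiplicative identity of $J$. The Peirce decomposition of $J$ with respect to $e$ is $J=J_1\oplus J_{\frac12}\oplus J_0$ with $J_i=\{x\in J: ex=ix\}$, $i=0,\frac12,1$ (for $i=\frac12$ the condition means $2(ex)=x$). A nonassociative monomial of degree $1$ is a single variable; a nonassociative monomial of degree $n>1$ is an expression $(u)(v)$ with $u$ a nonassociative monomial of some degree $i$ and $v$ one of degree $n-i$ ($1\le i\le n-1$). For a monomial $m=m(x_1,\dots,x_n)$ of degree $n$, with $n$ successive places, $m(y_1,\dots,y_n)$ denotes the value obtained by putting $y_1,\dots,y_n$ in these places. An $n$-multiplicative derivation of $J$ is a map $d:J\to J$, not assumed additive, such that $d(m(x_1,\dots,x_n))=\sum_{i=1}^n m(x_1,\dots,d(x_i),\dots,x_n)$ for all nonassociative monomials $m$ of degree $n$ and all $x_1,\dots,x_n\in J$. *)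

theory Defs
  imports Main
begin

text \<open>Rings here are neither assumed associative nor unital, so the library class
  \<open>ring\<close> does not apply.\<close>

class nonassoc_ring = ab_group_add + times +
  assumes nonassoc_distrib_left: "x * (y + z) = x * y + x * z"
    and nonassoc_distrib_right: "(x + y) * z = x * z + y * z"

class jordan_ring = nonassoc_ring +
  assumes jordan_commute: "x * y = y * x"
    and jordan_identity: "((x * x) * y) * x = (x * x) * (y * x)"

text \<open>Without a unit there is no \<open>of_nat\<close>, so the multiple \<open>kx\<close> is the sum of \<open>k\<close> copies
  of \<open>x\<close>.\<close>

definition torsion_free :: "'a::ab_group_add itself \<Rightarrow> nat \<Rightarrow> bool" where
  "torsion_free _ k \<longleftrightarrow> (\<forall>x::'a. (\<Sum>i<k. x) = 0 \<longrightarrow> x = 0)"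

definition nontrivial_idempotent :: "'a::nonassoc_ring \<Rightarrow> bool" where
  "nontrivial_idempotent e \<longleftrightarrow>
     e \<noteq> 0 \<and> e * e = e \<and> \<not> (\<forall>x. e * x = x \<and> x * e = x)"

definition peirce_1 :: "'a::nonassoc_ring \<Rightarrow> 'a set" where
  "peirce_1 e = {x. e * x = x}"

definition peirce_half :: "'a::nonassoc_ring \<Rightarrow> 'a set" where
  "peirce_half e = {x. e * x + e * x = x}"

definition peirce_0 :: "'a::nonassoc_ring \<Rightarrow> 'a set" where
  "peirce_0 e = {x. e * x = 0}"

text \<open>Only the successive places of a monomial matter for the values \<open>m(y\<^sub>1, \<dots>, y\<^sub>n)\<close>, not the
  names of its variables, so a monomial is represented by its bracketing.\<close>

datatype monomial = Place | Product monomial monomial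

primrec monomial_degree :: "monomial \<Rightarrow> nat" where
  "monomial_degree Place = 1"
| "monomial_degree (Product u v) = monomial_degree u + monomial_degree v"

text \<open>The places are numbered from \<open>0\<close>; of the sequence \<open>y\<close> only the first
  \<open>monomial_degree m\<close> entries are used.\<close>

primrec monomial_value :: "monomial \<Rightarrow> (nat \<Rightarrow> 'a) \<Rightarrow> 'a::times" where
  "monomial_value Place y = y 0"
| "monomial_value (Product u v) y =
     monomial_value u y * monomial_value v (\<lambda>i. y (monomial_degree u + i))"

lemma monomial_value_cong:
  assumes "\<And>i. i < monomial_degree m \<Longrightarrow> y i = z i"
  shows "monomial_value m y = monomial_value m z"
  using assms
proof (induction m arbitrary: y z)
  case Place
  then show ?case by simp
next
  case (Product u v)
  have "monomial_value u y = monomial_value u z"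
    by (rule Product.IH(1)) (simp add: Product.prems)
  moreover have "monomial_value v (\<lambda>i. y (monomial_degree u + i)) =
      monomial_value v (\<lambda>i. z (monomial_degree u + i))"
    by (rule Product.IH(2)) (simp add: Product.prems)
  ultimately show ?case by simp
qed

definition multiplicative_derivation :: "nat \<Rightarrow> ('a::nonassoc_ring \<Rightarrow> 'a) \<Rightarrow> bool" where
  "multiplicative_derivation n d \<longleftrightarrow>
     (\<forall>m x. monomial_degree m = n \<longrightarrow>
        d (monomial_value m x) = (\<Sum>i<n. monomial_value m (x(i := d (x i)))))"

end

theory Submission
  imports Defs
begin

text \<open>Everything is expressed through the additive defect
  \<open>f(a, b) = d(a + b) - d(a) - d(b)\<close>. In the derivation identity the terms in which \<open>d\<close> hits
  another place are additive in the given place, so they cancel in the defect: \<open>f\<close> commutes with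
  every map \<open>x \<mapsto> m(y\<^sub>1, \<dots>, x, \<dots>, y\<^sub>n)\<close>. Filling spare places with \<open>e\<close> shows that
  \<open>f\<close> commutes with multiplication by elements of \<open>eJ = J\<^sub>1 + J\<^sub>1\<^sub>/\<^sub>2\<close>; multiplication by
  \<open>n - 1\<close> elements of \<open>J\<^sub>0\<close> is used in place of multiplication by a single one. Together with the
  Peirce rules and conditions (i)--(iii), this forces the defect to vanish first across different
  Peirce components, then within \<open>J\<^sub>1\<^sub>/\<^sub>2\<close> (expanding \<open>(e + a)(e + b)\<close>), and finally within
  \<open>J\<^sub>1\<close> and \<open>J\<^sub>0\<close>.\<close>

section \<open>Additive defect of a multiplicative derivation\<close>

lemma nonassoc_mult_zero_left [simp]: "0 * x = (0::'a::nonassoc_ring)"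
  by (metis add_cancel_right_right nonassoc_distrib_right)

lemma nonassoc_mult_zero_right [simp]: "x * 0 = (0::'a::nonassoc_ring)"
  by (metis add_cancel_right_right nonassoc_distrib_left)

lemma nonassoc_mult_minus_left: "(- x) * y = - (x * y)" for x y :: "'a::nonassoc_ring"
  by (metis add.right_inverse minus_unique nonassoc_distrib_right nonassoc_mult_zero_left)

lemma nonassoc_mult_minus_right: "x * (- y) = - (x * y)" for x y :: "'a::nonassoc_ring"
  by (metis add.right_inverse minus_unique nonassoc_distrib_left nonassoc_mult_zero_right)

lemma nonassoc_diff_distrib_left: "x * (y - z) = x * y - x * z" for x y z :: "'a::nonassoc_ring"
  using nonassoc_distrib_left[of x y "- z"] by (simp add: nonassoc_mult_minus_right)

text \<open>The inductions on monomials use this in place of the defining equation, so that the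
  changed place stays visible in the one factor containing it.\<close>

lemma monomial_value_fun_upd_Product:
  "monomial_value (Product u v) (y(i := c)) =
    (if i < monomial_degree u
     then monomial_value u (y(i := c)) * monomial_value v (\<lambda>j. y (monomial_degree u + j))
     else monomial_value u y *
       monomial_value v ((\<lambda>j. y (monomial_degree u + j))(i - monomial_degree u := c)))"
proof (cases "i < monomial_degree u")
  case True
  then have "(\<lambda>j. (y(i := c)) (monomial_degree u + j)) = (\<lambda>j. y (monomial_degree u + j))"
    by auto
  with True show ?thesis by simp
next
  case False
  then have "(\<lambda>j. (y(i := c)) (monomial_degree u + j)) =
      (\<lambda>j. y (monomial_degree u + j))(i - monomial_degree u := c)"
    by (intro ext) auto
  moreover have "monomial_value u (y(i := c)) = monomial_value u y"
    using False by (intro monomial_value_cong) auto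
  ultimately show ?thesis using False by simp
qed

lemma monomial_value_add:
  fixes y :: "nat \<Rightarrow> 'a::nonassoc_ring"
  assumes "i < monomial_degree m"
  shows "monomial_value m (y(i := a + b)) =
    monomial_value m (y(i := a)) + monomial_value m (y(i := b))"
  using assms
proof (induction m arbitrary: y i)
  case Place
  then show ?case by simp
next
  case (Product u v)
  then show ?case
    by (simp add: monomial_value_fun_upd_Product nonassoc_distrib_left nonassoc_distrib_right
        del: monomial_value.simps fun_upd_apply)
qed

lemma monomial_value_minus:
  fixes y :: "nat \<Rightarrow> 'a::nonassoc_ring"
  assumes "i < monomial_degree m"
  shows "monomial_value m (y(i := - a)) = - monomial_value m (y(i := a))"
  using assms
proof (induction m arbitrary: y i)
  case Place
  then show ?case by simp
next
  case (Product u v)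
  then show ?case
    by (simp add: monomial_value_fun_upd_Product nonassoc_mult_minus_left
        nonassoc_mult_minus_right del: monomial_value.simps fun_upd_apply)
qed

definition additive_defect :: "('a::ab_group_add \<Rightarrow> 'a) \<Rightarrow> 'a \<Rightarrow> 'a \<Rightarrow> 'a" where
  "additive_defect d a b = d (a + b) - d a - d b"

lemma additive_defect_eq_0_iff: "additive_defect d a b = 0 \<longleftrightarrow> d (a + b) = d a + d b"
  unfolding additive_defect_def by (metis add_diff_cancel_left' diff_add_cancel diff_diff_eq eq_iff_diff_eq_0)

lemma additive_defect_commute: "additive_defect d a b = additive_defect d b a"
  by (simp add: additive_defect_def algebra_simps)

lemma additive_defect_monomial_value:
  fixes d :: "'a::nonassoc_ring \<Rightarrow> 'a"
  assumes d: "multiplicative_derivation n d" and m: "monomial_degree m = n" and i: "i < n"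
  shows "additive_defect d (monomial_value m (y(i := a))) (monomial_value m (y(i := b))) =
    monomial_value m (y(i := additive_defect d a b))"
proof -
  define G where "G c = (\<Sum>j\<in>{..<n} - {i}. monomial_value m ((y(j := d (y j)))(i := c)))" for c
  have G_add: "G (a + b) = G a + G b"
    unfolding G_def by (simp add: monomial_value_add m i sum.distrib)
  have expand: "d (monomial_value m (y(i := c))) = monomial_value m (y(i := d c)) + G c" for c
  proof -
    have "d (monomial_value m (y(i := c))) =
        (\<Sum>j<n. monomial_value m ((y(i := c))(j := d ((y(i := c)) j))))"
      using d m unfolding multiplicative_derivation_def by blast
    also have "\<dots> = monomial_value m (y(i := d c)) +
        (\<Sum>j\<in>{..<n} - {i}. monomial_value m ((y(i := c))(j := d ((y(i := c)) j))))"
      using i by (subst sum.remove[of _ i]) auto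
    also have "(\<Sum>j\<in>{..<n} - {i}. monomial_value m ((y(i := c))(j := d ((y(i := c)) j)))) = G c"
      unfolding G_def by (rule sum.cong) (simp_all add: fun_upd_twist[of i])
    finally show ?thesis .
  qed
  have "additive_defect d (monomial_value m (y(i := a))) (monomial_value m (y(i := b))) =
      d (monomial_value m (y(i := a + b))) - d (monomial_value m (y(i := a)))
      - d (monomial_value m (y(i := b)))"
    by (simp add: additive_defect_def monomial_value_add m i)
  also have "\<dots> = monomial_value m (y(i := d (a + b))) + monomial_value m (y(i := - d a))
      + monomial_value m (y(i := - d b))"
    by (simp add: expand G_add monomial_value_minus m i)
  also have "\<dots> = monomial_value m (y(i := d (a + b) + - d a + - d b))"
    by (simp only: monomial_value_add m i)
  finally show ?thesis by (simp add: additive_defect_def)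
qed

text \<open>As \<open>n >= 2\<close>, \<open>m\<close> is a product, so changing a single place of
  the zero assignment leaves one factor equal to 0.\<close>

lemma multiplicative_derivation_zero:
  fixes d :: "'a::nonassoc_ring \<Rightarrow> 'a"
  assumes "multiplicative_derivation n d" "monomial_degree m = n" "n \<ge> 2"
  shows "d 0 = 0"
proof -
  have zero: "monomial_value u (\<lambda>_. 0) = (0::'a)" for u
    by (induction u) auto
  have "monomial_value m ((\<lambda>_. 0)(i := c)) = 0" if "i < n" for i and c :: 'a
  proof (cases m)
    case Place
    with assms show ?thesis by simp
  next
    case (Product u v)
    then show ?thesis by (simp add: monomial_value_fun_upd_Product zero del: monomial_value.simps)
  qed
  then have "(\<Sum>i<n. monomial_value m ((\<lambda>_. 0)(i := d 0))) = 0"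
    by simp
  moreover have "d (monomial_value m (\<lambda>_. 0)) = (\<Sum>i<n. monomial_value m ((\<lambda>_. 0)(i := d 0)))"
    using assms(1,2) unfolding multiplicative_derivation_def by blast
  ultimately show ?thesis by (simp add: zero)
qed

text \<open>Yields \<open>k\<close> successive left multiplications of the last place, the operators
  used for factors from \<open>J0\<close>.\<close>

primrec right_comb :: "nat \<Rightarrow> monomial" where
  "right_comb 0 = Place"
| "right_comb (Suc k) = Product Place (right_comb k)"

lemma monomial_degree_right_comb [simp]: "monomial_degree (right_comb k) = Suc k"
  by (induction k) auto

lemma monomial_value_right_comb:
  "monomial_value (right_comb (length ts)) ((\<lambda>i. ts ! i)(length ts := a)) = foldr (*) ts a"
proof (induction ts)
  case Nil
  then show ?case by simp
next
  case (Cons t ts)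
  have "(\<lambda>i. ((\<lambda>i. (t # ts) ! i)(Suc (length ts) := a)) (Suc i)) =
      (\<lambda>i. ts ! i)(length ts := a)"
    by (intro ext) auto
  with Cons show ?case by (simp add: fun_upd_other del: fun_upd_apply)
qed

lemma monomial_value_idempotent:
  assumes "e * e = e"
  shows "monomial_value m (\<lambda>_. e) = e"
  by (induction m) (auto simp: assms)

section \<open>Peirce decomposition\<close>

text \<open>Full polarization of the Jordan identity in the variable that occurs in it three
  times.\<close>

lemma jordan_linearized:
  fixes x y z w :: "'a::jordan_ring"
  assumes no_2_torsion: "\<And>x::'a. x + x = 0 \<Longrightarrow> x = 0"
  shows "((x * z) * y) * w + ((z * w) * y) * x + ((w * x) * y) * z =
    (x * z) * (y * w) + (z * w) * (y * x) + (w * x) * (y * z)"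
proof -
  define F where "F a b c = ((a * b) * y) * c - (a * b) * (y * c)" for a b c
  have F_add: "F (a + a') b c = F a b c + F a' b c" "F a (b + b') c = F a b c + F a b' c"
    "F a b (c + c') = F a b c + F a b c'" for a a' b b' c c'
    by (simp_all add: F_def nonassoc_distrib_left nonassoc_distrib_right algebra_simps)
  have F_minus: "F (- a) b c = - F a b c" "F a (- b) c = - F a b c" "F a b (- c) = - F a b c"
    for a b c
    by (simp_all add: F_def nonassoc_mult_minus_left nonassoc_mult_minus_right)
  have F_comm: "F a b c = F b a c" for a b c
    by (simp add: F_def jordan_commute)
  have F_diag: "F a a a = 0" for a
    by (simp add: F_def jordan_identity)
  \<comment> \<open>Replacing \<open>b\<close> by \<open>-b\<close> separates the degrees (2,1) and (1,2), so that no division by 3 is needed.\<close>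
  have quad: "F a a b + F a b a + F b a a = 0" for a b
  proof -
    let ?p = "F a a b + F a b a + F b a a" and ?q = "F a b b + F b a b + F b b a"
    have 1: "?p + ?q = 0"
      using F_diag[of "a + b"] F_diag[of a] F_diag[of b] by (simp add: F_add add_ac)
    have 2: "?q - ?p = 0"
    proof -
      have "F (a + - b) (a + - b) (a + - b) = F a a a - F b b b + (?q - ?p)"
        unfolding F_add F_minus by (simp add: algebra_simps)
      then show ?thesis unfolding F_diag by simp
    qed
    from 2 have "?q = ?p" by (simp only: right_minus_eq)
    with 1 have "?p + ?p = 0" by (simp only:)
    then show ?thesis by (rule no_2_torsion)
  qed
  let ?r = "F x z w + F z w x + F w x z"
  \<comment> \<open>Second polarization: since \<open>F\<close> is symmetric in its first two
    arguments, each mixed term appears twice.\<close>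
  define Q where "Q a b = F a a b + F a b a + F b a a" for a b
  have "Q (x + z) w = Q x w + Q z w + (?r + ?r)"
    by (simp add: Q_def F_add F_comm[of z x] F_comm[of w x] F_comm[of w z] add_ac)
  then have "?r + ?r = 0" by (simp add: Q_def quad)
  then have "?r = 0" by (rule no_2_torsion)
  then show ?thesis
    by (simp add: F_def algebra_simps)
qed

locale peirce =
  fixes e :: "'a::jordan_ring"
  assumes no_2_torsion: "\<And>x::'a. x + x = 0 \<Longrightarrow> x = 0"
    and idempotent: "e * e = e"
begin

abbreviation "J1 \<equiv> peirce_1 e"
abbreviation "Jh \<equiv> peirce_half e"
abbreviation "J0 \<equiv> peirce_0 e"

lemmas peirce_defs = peirce_1_def peirce_half_def peirce_0_def

lemma mult_comm: "x * y = y * x" for x y :: 'a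
  by (rule jordan_commute)

lemma idempotent_mem_J1: "e \<in> J1"
  by (simp add: peirce_1_def idempotent)

lemma J1_iff: "x \<in> J1 \<longleftrightarrow> e * x = x"
  by (simp add: peirce_1_def)

lemma Jh_iff: "x \<in> Jh \<longleftrightarrow> e * x + e * x = x"
  by (simp add: peirce_half_def)

lemma J0_iff: "x \<in> J0 \<longleftrightarrow> e * x = 0"
  by (simp add: peirce_0_def)

lemma peirce_add:
  "x \<in> J1 \<Longrightarrow> y \<in> J1 \<Longrightarrow> x + y \<in> J1"
  "x \<in> Jh \<Longrightarrow> y \<in> Jh \<Longrightarrow> x + y \<in> Jh"
  "x \<in> J0 \<Longrightarrow> y \<in> J0 \<Longrightarrow> x + y \<in> J0"
proof -
  show "x + y \<in> Jh" if "x \<in> Jh" "y \<in> Jh"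
  proof -
    have "e * (x + y) + e * (x + y) = (e * x + e * x) + (e * y + e * y)"
      by (simp add: nonassoc_distrib_left add_ac)
    with that show ?thesis by (simp add: Jh_iff)
  qed
qed (simp_all add: J1_iff J0_iff nonassoc_distrib_left)

lemma J1_minus: "x \<in> J1 \<Longrightarrow> - x \<in> J1"
  by (simp add: J1_iff nonassoc_mult_minus_right)

lemma idempotent_mult_Jh: "x \<in> Jh \<Longrightarrow> e * x \<in> Jh"
  by (simp add: Jh_iff flip: nonassoc_distrib_left)

text \<open>For L the multiplication by \<open>e\<close> this is L (2L - 1) (L - 1) = 0, the source
  of the eigenvalues 0, 1/2 and 1.\<close>

lemma peirce_cubic:
  "e * x + e * (e * (e * x)) + e * (e * (e * x)) = e * (e * x) + e * (e * x) + e * (e * x)"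
  using jordan_linearized[OF no_2_torsion, where x = e and y = e and z = e and w = x]
  by (simp add: idempotent mult_comm[of x e] mult_comm[of "e * x" e] mult_comm[of "e * (e * x)" e])

lemma peirce_decomposition:
  obtains x1 xh x0 where "x1 \<in> J1" "xh \<in> Jh" "x0 \<in> J0" "x = x1 + xh + x0"
proof -
  \<comment> \<open>With L the multiplication by \<open>e\<close>, the components are the Lagrange
    projections 2L^2 - L, 4 (L - L^2) and 1 - 3L + 2L^2 applied to \<open>x\<close>; all
    coefficients are integers.\<close>
  define p q where "p = e * x" and "q = e * p"
  have cubic: "e * q + e * q = q + q + q - p"
    using peirce_cubic[of x] unfolding p_def q_def by (simp add: algebra_simps)
  show ?thesis
  proof
    have "e * (q + q - p) = q + q + q - p - q"
      using cubic by (simp add: nonassoc_distrib_left nonassoc_diff_distrib_left flip: q_def p_def)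
    then show "q + q - p \<in> J1" by (simp add: J1_iff)
    have half: "e * (p + p - q - q) = q + q - (e * q + e * q)"
      by (simp add: nonassoc_distrib_left nonassoc_diff_distrib_left algebra_simps
          flip: q_def p_def)
    have "(p + p - q - q) \<in> Jh"
      unfolding Jh_iff half cubic by (simp add: algebra_simps)
    then show "(p + p - q - q) + (p + p - q - q) \<in> Jh" by (rule peirce_add) fact
    have "e * (x - p - p - p + q + q) = p - q - q - q + (e * q + e * q)"
      by (simp add: nonassoc_distrib_left nonassoc_diff_distrib_left algebra_simps
          flip: q_def p_def)
    then show "x - p - p - p + q + q \<in> J0"
      unfolding J0_iff cubic by (simp add: algebra_simps)
    show "x = (q + q - p) + ((p + p - q - q) + (p + p - q - q)) + (x - p - p - p + q + q)"
      by (simp add: algebra_simps)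
  qed
qed

text \<open>Multiplying the relation by \<open>e\<close> once and twice gives
  \<open>e * xh = e * (e * xh)\<close>, whereas \<open>e * xh\<close>, being in \<open>Jh\<close>,
  is twice \<open>e * (e * xh)\<close>; so \<open>e * xh\<close> vanishes.\<close>

lemma peirce_direct:
  assumes "x1 \<in> J1" "xh \<in> Jh" "x0 \<in> J0" "x1 + xh + x0 = 0"
  shows "x1 = 0" "xh = 0" "x0 = 0"
proof -
  have 1: "x1 + e * xh = 0"
  proof -
    have "e * x1 + e * xh + e * x0 = 0" by (simp add: assms(4) flip: nonassoc_distrib_left)
    then show ?thesis using assms by (simp add: J1_iff J0_iff)
  qed
  have 2: "x1 + e * (e * xh) = 0"
  proof -
    have "e * x1 + e * (e * xh) = 0" by (simp add: 1 flip: nonassoc_distrib_left)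
    then show ?thesis using assms by (simp add: J1_iff)
  qed
  have "e * xh = e * (e * xh)" using 1 2 by (metis add_left_cancel)
  moreover have "e * (e * xh) + e * (e * xh) = e * xh"
    using idempotent_mult_Jh[OF assms(2)] by (simp add: Jh_iff)
  ultimately have *: "e * xh = 0" by simp
  then show "xh = 0" using assms(2) by (simp add: Jh_iff)
  moreover show "x1 = 0" using 1 * by simp
  ultimately show "x0 = 0" using assms(4) by simp
qed

lemma Jh_inter_J1_plus_J0:
  assumes "x1 \<in> J1" "x0 \<in> J0" "x1 + x0 \<in> Jh"
  shows "x1 + x0 = 0"
proof -
  have "- (x1 + x0) \<in> Jh"
    using assms(3) unfolding Jh_iff nonassoc_mult_minus_right
    by (metis minus_add_distrib)
  moreover have "x1 + - (x1 + x0) + x0 = 0" by (simp add: algebra_simps)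
  ultimately have "- (x1 + x0) = 0" using peirce_direct(2) assms(1,2) by blast
  then show ?thesis by (simp only: neg_equal_0_iff_equal)
qed

lemma zero_mem_peirce: "0 \<in> J1" "0 \<in> Jh" "0 \<in> J0"
  by (simp_all add: peirce_defs)

lemma Jh_inter_J1: "x \<in> Jh \<Longrightarrow> x \<in> J1 \<Longrightarrow> x = 0"
  using Jh_inter_J1_plus_J0[of x 0] zero_mem_peirce by simp

lemma Jh_inter_J0: "x \<in> Jh \<Longrightarrow> x \<in> J0 \<Longrightarrow> x = 0"
  using Jh_inter_J1_plus_J0[of 0 x] zero_mem_peirce by simp

section \<open>Multiplication rules between the Peirce components\<close>

lemma peirce_product_identity:
  "(e * y) * w + (e * ((e * w) * y) + e * ((e * w) * y)) =
    e * (y * w) + ((e * w) * (e * y) + (e * w) * (e * y))"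
  using jordan_linearized[OF no_2_torsion, where x = e and y = y and z = e and w = w]
  by (simp add: idempotent mult_comm[of w e] mult_comm[of y e] mult_comm[of "e * w * y" e] add_ac)

text \<open>Put \<open>e * w = w\<close> in \<open>peirce_product_identity\<close>, and
  \<open>e * w = 0\<close> for \<open>mult_J0\<close>: multiplication by \<open>w\<close> commutes
  with that by \<open>e\<close> and so preserves its eigenspaces.\<close>

lemma mult_J1: "w \<in> J1 \<Longrightarrow> e * (y * w) = (e * y) * w"
  using peirce_product_identity[of y w]
  by (simp add: J1_iff mult_comm[of w y] mult_comm[of w "e * y"])

lemma mult_J0: "w \<in> J0 \<Longrightarrow> e * (y * w) = (e * y) * w"
  using peirce_product_identity[of y w] by (simp add: J0_iff)

text \<open>\<open>e * (x * y)\<close> equals \<open>x * y\<close> when \<open>e\<close> is moved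
  onto \<open>x\<close>, and 0 when it is moved onto \<open>y\<close>.\<close>

lemma J1_mult_J0: "x \<in> J1 \<Longrightarrow> y \<in> J0 \<Longrightarrow> x * y = 0"
  using mult_J1[of x y] mult_J0[of y x] by (simp add: J1_iff J0_iff mult_comm[of y x])

lemma J0_mult_J1: "x \<in> J0 \<Longrightarrow> y \<in> J1 \<Longrightarrow> x * y = 0"
  using J1_mult_J0 mult_comm by metis

lemma J0_mult_J0: "x \<in> J0 \<Longrightarrow> y \<in> J0 \<Longrightarrow> x * y \<in> J0"
  using mult_J0[of y x] by (simp add: J0_iff)

lemma Jh_mult_J1: "x \<in> Jh \<Longrightarrow> y \<in> J1 \<Longrightarrow> x * y \<in> Jh"
  using mult_J1[of y x] by (simp add: Jh_iff flip: nonassoc_distrib_right)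

lemma Jh_mult_J0: "x \<in> Jh \<Longrightarrow> y \<in> J0 \<Longrightarrow> x * y \<in> Jh"
  using mult_J0[of y x] by (simp add: Jh_iff flip: nonassoc_distrib_right)

lemma J0_mult_Jh: "x \<in> J0 \<Longrightarrow> y \<in> Jh \<Longrightarrow> x * y \<in> Jh"
  using Jh_mult_J0 mult_comm by metis

text \<open>Applying \<open>e\<close> twice to \<open>x * z\<close> gives the same as applying it
  once, so \<open>e * (x * z)\<close> and its complement are the two components.\<close>

lemma Jh_mult_Jh:
  assumes x: "x \<in> Jh" and z: "z \<in> Jh"
  obtains c1 c0 where "c1 \<in> J1" "c0 \<in> J0" "x * z = c1 + c0"
proof -
  define p q r s where "p = e * x" and "q = e * p" and "r = e * z" and "s = e * r"
  have pq: "x = p + p" "p = q + q" "z = r + r" "r = s + s"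
    using x z idempotent_mult_Jh[OF x] idempotent_mult_Jh[OF z]
    unfolding p_def q_def r_def s_def by (simp_all add: Jh_iff)
  have "e * (e * (x * z)) + (s * x + q * z) = e * (x * z) + (r * p + p * r)"
    using jordan_linearized[OF no_2_torsion, where x = x and y = e and z = z and w = e]
    by (simp add: p_def q_def r_def s_def idempotent mult_comm[of x e] mult_comm[of z e]
        mult_comm[of "e * x" e] mult_comm[of "e * z" e] mult_comm[of "x * z" e]
        mult_comm[of "e * (x * z)" e] add_ac)
  \<comment> \<open>Here x = 4q, p = 2q, z = 4s and r = 2s, so both sides are 8 (q s).\<close>
  moreover have "s * x + q * z = r * p + p * r"
    unfolding pq(1,3) unfolding pq(2,4)
    by (simp add: nonassoc_distrib_left nonassoc_distrib_right mult_comm[of s q] add_ac)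
  ultimately have idem: "e * (e * (x * z)) = e * (x * z)" by simp
  show ?thesis
  proof
    show "e * (x * z) \<in> J1" using idem by (simp add: J1_iff)
    show "x * z - e * (x * z) \<in> J0"
      using idem by (simp add: J0_iff nonassoc_diff_distrib_left)
    show "x * z = e * (x * z) + (x * z - e * (x * z))" by simp
  qed
qed

end

section \<open>Vanishing of the defect\<close>

locale peirce_derivation = peirce +
  fixes n :: nat and d :: "'a \<Rightarrow> 'a"
  assumes degree: "n \<ge> 2"
    and derivation: "multiplicative_derivation n d"
    and faithful_J1: "\<And>a. a \<in> J1 \<Longrightarrow> (\<And>t. t \<in> Jh \<Longrightarrow> t * a = 0) \<Longrightarrow> a = 0"
    and faithful_J0: "\<And>a. a \<in> J0 \<Longrightarrow> (\<And>t. t \<in> Jh \<Longrightarrow> t * a = 0) \<Longrightarrow> a = 0"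
    and faithful_J0_J0: "\<And>a. a \<in> J0 \<Longrightarrow> (\<And>t. t \<in> J0 \<Longrightarrow> t * a = 0) \<Longrightarrow> a = 0"
    and faithful_J0_Jh: "\<And>a. a \<in> Jh \<Longrightarrow> (\<And>t. t \<in> J0 \<Longrightarrow> t * a = 0) \<Longrightarrow> a = 0"
begin

section \<open>Multiplications that commute with the defect\<close>

abbreviation f :: "'a \<Rightarrow> 'a \<Rightarrow> 'a" where "f \<equiv> additive_defect d"

lemma d_zero: "d 0 = 0"
  using multiplicative_derivation_zero[OF derivation, of "right_comb (n - 1)"] degree by simp

lemma f_zero [simp]: "f a 0 = 0" "f 0 a = 0"
  by (simp_all add: additive_defect_def d_zero)

lemma f_idempotent_mult: "f (e * a) (e * b) = e * f a b"
proof -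
  have "monomial_value (Product (right_comb (n - 2)) Place) ((\<lambda>_. e)(n - 1 := c)) = e * c" for c
    using degree
    by (simp add: monomial_value_fun_upd_Product monomial_value_idempotent idempotent
        del: monomial_value.simps(2)) auto
  with additive_defect_monomial_value[OF derivation,
      of "Product (right_comb (n - 2)) Place" "n - 1" "\<lambda>_. e" a b] degree
  show ?thesis by simp
qed

lemma f_mult_degree_2:
  assumes "n = 2"
  shows "f (x * a) (x * b) = x * f a b"
  using additive_defect_monomial_value[OF derivation,
      of "Product Place Place" 1 "\<lambda>_. x" a b] assms by simp

text \<open>The first \<open>n - 2\<close> places collapse to \<open>e\<close>, so two places stay
  free and either can be varied. This takes three places; the case \<open>n = 2\<close> is treated
  directly.\<close>

lemma monomial_value_padded:
  assumes "n \<ge> 3"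
  shows "monomial_value (Product (Product (right_comb (n - 3)) Place) Place)
    ((\<lambda>_. e)(n - 2 := z, n - 1 := a)) = (e * z) * a"
proof -
  have "n - 1 - (Suc (Suc (n - 3))) = 0" "\<not> n - 1 < Suc (Suc (n - 3))" using assms by auto
  moreover have "monomial_value (Product (right_comb (n - 3)) Place) ((\<lambda>_. e)(n - 2 := z)) = e * z"
    using assms
    by (simp add: monomial_value_fun_upd_Product monomial_value_idempotent idempotent
        del: monomial_value.simps(2)) auto
  ultimately show ?thesis
    by (simp add: monomial_value_fun_upd_Product del: monomial_value.simps(2))
qed

lemma f_mult_left: "f ((e * z) * a) ((e * z) * b) = (e * z) * f a b"
proof (cases "n = 2")
  case True
  then show ?thesis by (rule f_mult_degree_2)
next
  case False
  with degree have n: "n \<ge> 3" by simp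
  then have "monomial_degree (Product (Product (right_comb (n - 3)) Place) Place) = n" "n - 1 < n"
    by auto
  from additive_defect_monomial_value[OF derivation this, of "(\<lambda>_. e)(n - 2 := z)" a b]
  show ?thesis by (simp only: monomial_value_padded[OF n])
qed

lemma f_mult_right: "f ((e * a) * y) ((e * b) * y) = f (e * a) (e * b) * y"
proof (cases "n = 2")
  case True
  then show ?thesis using f_mult_degree_2[of y "e * a" "e * b"] by (simp add: mult_comm[of y])
next
  case False
  with degree have n: "n \<ge> 3" by simp
  have swap: "(\<lambda>_. e)(n - 1 := y, n - 2 := c) = (\<lambda>_. e)(n - 2 := c, n - 1 := y)" for c
    using n by (intro fun_upd_twist) auto
  have "monomial_degree (Product (Product (right_comb (n - 3)) Place) Place) = n" "n - 2 < n"
    using n by auto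
  from additive_defect_monomial_value[OF derivation this, of "(\<lambda>_. e)(n - 1 := y)" a b]
  have "f ((e * a) * y) ((e * b) * y) = (e * f a b) * y"
    by (simp only: swap monomial_value_padded[OF n])
  then show ?thesis by (simp add: f_idempotent_mult)
qed

lemma f_mult_Jh:
  assumes "t \<in> Jh"
  shows "t * f a b = f (t * a) (t * b)"
proof -
  have "t = e * (t + t)" using assms by (simp add: Jh_iff nonassoc_distrib_left)
  then show ?thesis using f_mult_left[of "t + t" a b] by simp
qed

text \<open>A nonzero element of \<open>J0\<close> is not of the form \<open>e * z\<close>, so
  \<open>f_mult_left\<close> does not reach it. Here all \<open>n - 1\<close> left places of the
  right comb carry arbitrary multipliers.\<close>

lemma f_foldr:
  assumes "length ts = n - 1"
  shows "foldr (*) ts (f a b) = f (foldr (*) ts a) (foldr (*) ts b)"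
proof -
  have "monomial_degree (right_comb (length ts)) = n" "length ts < n"
    using assms degree by auto
  from additive_defect_monomial_value[OF derivation this, of "\<lambda>i. ts ! i" a b]
  show ?thesis by (simp only: monomial_value_right_comb)
qed

section \<open>Iterated multiplication by elements of \<open>J0\<close>\<close>

lemma foldr_add: "foldr (*) ts (a + b) = foldr (*) ts a + (foldr (*) ts b :: 'a)"
  by (induction ts) (auto simp: nonassoc_distrib_left)

lemma foldr_J0: "set ts \<subseteq> J0 \<Longrightarrow> a \<in> J0 \<Longrightarrow> foldr (*) ts a \<in> J0"
  by (induction ts) (auto simp: J0_mult_J0)

lemma foldr_Jh: "set ts \<subseteq> J0 \<Longrightarrow> a \<in> Jh \<Longrightarrow> foldr (*) ts a \<in> Jh"
  by (induction ts) (auto simp: J0_mult_Jh)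

text \<open>\<open>n >= 2\<close> provides at least one factor, and the innermost one already
  annihilates \<open>a\<close>.\<close>

lemma foldr_J1:
  assumes "set ts \<subseteq> J0" "length ts = n - 1" "a \<in> J1"
  shows "foldr (*) ts a = 0"
proof -
  from assms degree have "ts \<noteq> []" by auto
  then obtain us t where ts: "ts = us @ [t]" by (metis rev_exhaust)
  have "foldr (*) us (0::'a) = 0" by (induction us) auto
  with ts assms show ?thesis by (simp add: J0_mult_J1)
qed

text \<open>Conditions (ii) and (iii) cancel the factors one at a time. By induction
  \<open>t * x\<close> lies in \<open>J1\<close> for the innermost factor \<open>t\<close>; as it is
  also the sum of \<open>t * xh\<close> in \<open>Jh\<close> and \<open>t * x0\<close> in
  \<open>J0\<close>, both summands vanish.\<close>

lemma mem_J1_if_foldr_eq_0: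
  assumes "\<And>ts. length ts = k \<Longrightarrow> set ts \<subseteq> J0 \<Longrightarrow> foldr (*) ts x = 0"
  shows "x \<in> J1"
  using assms
proof (induction k arbitrary: x)
  case 0
  from 0[of "[]"] show ?case by (simp add: zero_mem_peirce)
next
  case (Suc k)
  obtain x1 xh x0 where x: "x1 \<in> J1" "xh \<in> Jh" "x0 \<in> J0" "x = x1 + xh + x0"
    by (rule peirce_decomposition)
  have kill: "t * xh = 0 \<and> t * x0 = 0" if t: "t \<in> J0" for t
  proof -
    have "t * x \<in> J1"
    proof (rule Suc.IH)
      fix ts assume "length ts = k" "set ts \<subseteq> J0"
      with Suc.prems[of "ts @ [t]"] t show "foldr (*) ts (t * x) = 0" by simp
    qed
    moreover have "t * x = t * xh + t * x0"
      using x t by (simp add: nonassoc_distrib_left J0_mult_J1)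
    ultimately have "- (t * x) \<in> J1" "- (t * x) + t * xh + t * x0 = 0"
      by (simp_all only: J1_minus) (simp add: algebra_simps)
    then show ?thesis
      using peirce_direct J0_mult_Jh[OF t x(2)] J0_mult_J0[OF t x(3)] by blast
  qed
  have "xh = 0" using faithful_J0_Jh x kill by blast
  moreover have "x0 = 0" using faithful_J0_J0 x kill by blast
  ultimately show ?case using x by simp
qed

text \<open>Multiplying by \<open>n - 1\<close> elements of \<open>J0\<close> erases the
  \<open>J1\<close> parts of \<open>a\<close> and \<open>b\<close>, so the defect has to be known
  only on what is left.\<close>

lemma f_mem_J1:
  assumes "\<And>ts. length ts = n - 1 \<Longrightarrow> set ts \<subseteq> J0 \<Longrightarrow> f (foldr (*) ts a) (foldr (*) ts b) = 0"
  shows "f a b \<in> J1"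
  by (rule mem_J1_if_foldr_eq_0[of "n - 1"]) (simp add: f_foldr assms)

section \<open>The defect across different Peirce components\<close>

lemma f_J1_J0:
  assumes "a \<in> J1" "b \<in> J0"
  shows "f a b = 0"
proof -
  have "f a b \<in> J1" by (rule f_mem_J1) (simp add: foldr_J1 assms)
  moreover have "e * f a b = 0"
    using f_idempotent_mult[of a b] assms by (simp add: J0_iff)
  ultimately show ?thesis by (simp add: J1_iff)
qed

lemma f_J0_right_mem_J0:
  assumes "b \<in> J0"
  shows "f a b \<in> J0"
  using f_idempotent_mult[of a b] assms by (simp add: J0_iff)

text \<open>For \<open>t\<close> in \<open>Jh\<close>, multiplication by \<open>J0\<close> removes
  the \<open>J1\<close> part of \<open>t * a\<close>. The remaining defect lies in \<open>J0\<close>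
  by the previous lemma and in \<open>Jh\<close> as an iterated multiple of
  \<open>t * f a b\<close>, so it is 0. Hence \<open>t * f a b\<close> lies in both
  \<open>J1\<close> and \<open>Jh\<close>.\<close>

lemma f_Jh_J0:
  assumes a: "a \<in> Jh" and b: "b \<in> J0"
  shows "f a b = 0"
proof (rule faithful_J0)
  show f0: "f a b \<in> J0" using b by (rule f_J0_right_mem_J0)
  fix t assume t: "t \<in> Jh"
  have th: "t * f a b \<in> Jh" using t f0 by (rule Jh_mult_J0)
  obtain c1 c0 where c: "c1 \<in> J1" "c0 \<in> J0" "t * a = c1 + c0"
    using Jh_mult_Jh[OF t a] .
  have "t * f a b \<in> J1"
  proof (rule mem_J1_if_foldr_eq_0[of "n - 1"])
    fix ts assume ts: "length ts = n - 1" "set ts \<subseteq> J0"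
    have "foldr (*) ts (t * f a b) = f (foldr (*) ts (t * a)) (foldr (*) ts (t * b))"
      by (simp add: f_mult_Jh[OF t] f_foldr ts)
    also have "\<dots> = f (foldr (*) ts (t * b)) (foldr (*) ts c0)"
      using c ts by (simp add: foldr_add foldr_J1 additive_defect_commute)
    also have "\<dots> \<in> J0" using c ts by (intro f_J0_right_mem_J0 foldr_J0)
    finally show "foldr (*) ts (t * f a b) = 0"
      using foldr_Jh[OF ts(2) th] by (simp add: Jh_inter_J0)
  qed
  with th show "t * f a b = 0" by (rule Jh_inter_J1)
qed

text \<open>For \<open>t\<close> in \<open>Jh\<close>, \<open>t * a\<close> lies in
  \<open>Jh\<close> and \<open>t * b\<close> in \<open>J1 + J0\<close>; iterated multiplication by
  \<open>J0\<close> then reduces to \<open>f_Jh_J0\<close>.\<close>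

lemma f_J1_Jh:
  assumes a: "a \<in> J1" and b: "b \<in> Jh"
  shows "f a b = 0"
proof (rule faithful_J1)
  show f1: "f a b \<in> J1" by (rule f_mem_J1) (simp add: foldr_J1 a)
  fix t assume t: "t \<in> Jh"
  have th: "t * f a b \<in> Jh" using t f1 by (rule Jh_mult_J1)
  obtain c1 c0 where c: "c1 \<in> J1" "c0 \<in> J0" "t * b = c1 + c0"
    using Jh_mult_Jh[OF t b] .
  have "f (t * a) (t * b) \<in> J1"
  proof (rule f_mem_J1)
    fix ts assume ts: "length ts = n - 1" "set ts \<subseteq> J0"
    have "foldr (*) ts (t * b) = foldr (*) ts c0" using c ts by (simp add: foldr_add foldr_J1)
    then show "f (foldr (*) ts (t * a)) (foldr (*) ts (t * b)) = 0"
      using ts c t a by (simp add: f_Jh_J0 foldr_Jh foldr_J0 Jh_mult_J1)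
  qed
  then show "t * f a b = 0" using th by (simp add: f_mult_Jh[OF t] Jh_inter_J1)
qed

lemma f_J1_plus_Jh_J0:
  assumes "a \<in> J1" "b \<in> Jh" "c \<in> J0"
  shows "f (a + b) c = 0"
proof -
  have "f (a + b) c \<in> J1"
    by (rule f_mem_J1) (simp add: foldr_add foldr_J1 foldr_Jh foldr_J0 f_Jh_J0 assms)
  moreover have "f (a + b) c \<in> J0" using assms(3) by (rule f_J0_right_mem_J0)
  ultimately show ?thesis by (simp add: J1_iff J0_iff)
qed

lemma d_peirce_sum:
  assumes "a \<in> J1" "b \<in> Jh" "c \<in> J0"
  shows "d (a + b + c) = d a + d b + d c"
  using f_J1_plus_Jh_J0[OF assms] f_J1_Jh[OF assms(1,2)] by (simp add: additive_defect_eq_0_iff)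

section \<open>The defect within one Peirce component\<close>

lemma f_J1_J1_mem_J1:
  assumes "a \<in> J1" "b \<in> J1"
  shows "f a b \<in> J1"
  using f_idempotent_mult[of a b] assms by (simp add: J1_iff)

text \<open>With p = 2a and q = 2b, (e + p)(e + q) = e + a + b + pq. Distributing \<open>d\<close>
  over the four products, and also over the Peirce components e + c1, a + b and c0 of the result,
  gives \<open>f a b = - f e c1\<close>.\<close>

lemma f_Jh_Jh_mem_J1:
  assumes a: "a \<in> Jh" and b: "b \<in> Jh"
  shows "f a b \<in> J1"
proof -
  define p q where "p = a + a" and "q = b + b"
  have pq: "p \<in> Jh" "q \<in> Jh" unfolding p_def q_def by (intro peirce_add a b)+
  have ep: "e * p = a" "e * q = b"
    using a b by (simp_all add: p_def q_def Jh_iff nonassoc_distrib_left)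
  have p: "p = e * (p + p)" using pq by (simp add: Jh_iff nonassoc_distrib_left)
  \<comment> \<open>\<open>f_mult_left\<close> asks for a left factor of the form
    \<open>e * z\<close>.\<close>
  have ep_sum: "e + p = e * (e + (p + p))"
    unfolding nonassoc_distrib_left[of e e] idempotent by (simp only: p[symmetric])
  obtain c1 c0 where c: "c1 \<in> J1" "c0 \<in> J0" "p * q = c1 + c0"
    using Jh_mult_Jh[OF pq] .
  \<comment> \<open>\<open>e\<close> and \<open>p\<close> are both of the form \<open>e * z\<close>
    and have zero defect, so \<open>f_mult_right\<close> lets \<open>d\<close> split over the left
    factor \<open>e + p\<close>.\<close>
  have fp: "f (e * y) (p * y) = 0" for y
    using f_mult_right[of e y "p + p"] f_J1_Jh[OF idempotent_mem_J1 pq(1)]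
    by (simp add: idempotent flip: p)
  have "f ((e + p) * e) ((e + p) * q) = 0"
    using f_mult_left[of "e + (p + p)" e q] f_J1_Jh[OF idempotent_mem_J1 pq(2)]
    by (simp flip: ep_sum)
  then have "d ((e + p) * e + (e + p) * q) = d (e * e + p * e) + d (e * q + p * q)"
    by (simp add: additive_defect_eq_0_iff nonassoc_distrib_right)
  also have "\<dots> = d e + d a + (d b + d (p * q))"
    using fp[of e] fp[of q] by (simp add: additive_defect_eq_0_iff ep idempotent mult_comm[of p e])
  also have "d (p * q) = d c1 + d c0"
    using f_J1_J0[OF c(1,2)] c(3) by (simp add: additive_defect_eq_0_iff)
  finally have "d ((e + p) * e + (e + p) * q) = d e + d a + (d b + (d c1 + d c0))" .
  moreover have "(e + p) * e + (e + p) * q = (e + c1) + (a + b) + c0"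
    using c(3) ep by (simp add: nonassoc_distrib_right idempotent mult_comm[of p e] add_ac)
  moreover have "d ((e + c1) + (a + b) + c0) = d (e + c1) + d (a + b) + d c0"
    by (intro d_peirce_sum peirce_add idempotent_mem_J1 a b c)
  ultimately have "d (e + c1) + d (a + b) + d c0 = d e + d a + (d b + (d c1 + d c0))"
    by simp
  then have "f a b = - f e c1"
    by (simp add: additive_defect_def algebra_simps)
  then show ?thesis using f_J1_J1_mem_J1[OF idempotent_mem_J1 c(1)] J1_minus by simp
qed

text \<open>\<open>t * f a b\<close> lies in \<open>Jh\<close>, because \<open>f a b\<close> is in
  \<open>J1\<close>. Splitting \<open>t * a\<close> and \<open>t * b\<close> into components writes
  it as \<open>f a1 b1 + f a0 b0\<close>, an element of \<open>J1 + J0\<close>.\<close>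

lemma f_Jh_Jh:
  assumes a: "a \<in> Jh" and b: "b \<in> Jh"
  shows "f a b = 0"
proof (rule faithful_J1)
  show f1: "f a b \<in> J1" using a b by (rule f_Jh_Jh_mem_J1)
  fix t assume t: "t \<in> Jh"
  obtain a1 a0 where a': "a1 \<in> J1" "a0 \<in> J0" "t * a = a1 + a0"
    using Jh_mult_Jh[OF t a] .
  obtain b1 b0 where b': "b1 \<in> J1" "b0 \<in> J0" "t * b = b1 + b0"
    using Jh_mult_Jh[OF t b] .
  have split: "d (x + y) = d x + d y" if "x \<in> J1" "y \<in> J0" for x y
    using f_J1_J0[OF that] by (simp add: additive_defect_eq_0_iff)
  have "d ((a1 + a0) + (b1 + b0)) = d (a1 + b1) + d (a0 + b0)"
    using split[of "a1 + b1" "a0 + b0"] a' b' peirce_add by (simp add: add_ac)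
  then have "f (t * a) (t * b) = f a1 b1 + f a0 b0"
    using split[OF a'(1,2)] split[OF b'(1,2)]
    by (simp add: additive_defect_def a'(3) b'(3) algebra_simps)
  then have "t * f a b = f a1 b1 + f a0 b0" by (simp add: f_mult_Jh[OF t])
  with Jh_mult_J1[OF t f1] show "t * f a b = 0"
    using Jh_inter_J1_plus_J0[OF f_J1_J1_mem_J1[OF a'(1) b'(1)] f_J0_right_mem_J0[OF b'(2)]] by simp
qed

text \<open>A factor from \<open>Jh\<close> moves both arguments into \<open>Jh\<close>, where the
  defect vanishes; condition (i) concludes. The same works for \<open>J0\<close>.\<close>

lemma f_J1_J1:
  assumes "a \<in> J1" "b \<in> J1"
  shows "f a b = 0"
  by (rule faithful_J1) (simp_all add: assms f_J1_J1_mem_J1 f_mult_Jh f_Jh_Jh Jh_mult_J1)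

lemma f_J0_J0:
  assumes "a \<in> J0" "b \<in> J0"
  shows "f a b = 0"
  by (rule faithful_J0) (simp_all add: assms f_J0_right_mem_J0 f_mult_Jh f_Jh_Jh Jh_mult_J0)

lemma d_add: "d (a + b) = d a + d b"
proof -
  obtain a1 ah a0 where a: "a1 \<in> J1" "ah \<in> Jh" "a0 \<in> J0" "a = a1 + ah + a0"
    by (rule peirce_decomposition)
  obtain b1 bh b0 where b: "b1 \<in> J1" "bh \<in> Jh" "b0 \<in> J0" "b = b1 + bh + b0"
    by (rule peirce_decomposition)
  have "a + b = (a1 + b1) + (ah + bh) + (a0 + b0)"
    using a b by (simp add: add_ac)
  also have "d \<dots> = d (a1 + b1) + d (ah + bh) + d (a0 + b0)"
    by (intro d_peirce_sum peirce_add a b)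
  also have "\<dots> = (d a1 + d b1) + (d ah + d bh) + (d a0 + d b0)"
    using f_J1_J1[OF a(1) b(1)] f_Jh_Jh[OF a(2) b(2)] f_J0_J0[OF a(3) b(3)]
    by (simp add: additive_defect_eq_0_iff)
  also have "\<dots> = d a + d b"
    unfolding a(4) b(4) d_peirce_sum[OF a(1-3)] d_peirce_sum[OF b(1-3)] by (simp add: add_ac)
  finally show ?thesis .
qed

end

theorem theorem2:
  fixes n :: nat and e :: "'a::jordan_ring" and d :: "'a \<Rightarrow> 'a"
  assumes "n \<ge> 2"
    and "torsion_free TYPE('a) 2"
    and "torsion_free TYPE('a) (n - 1)"
    and "nontrivial_idempotent e"
    and "\<And>S a. S \<in> {peirce_1 e, peirce_0 e} \<Longrightarrow> a \<in> S \<Longrightarrow>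
           (\<forall>t \<in> peirce_half e. t * a = 0) \<Longrightarrow> a = 0"
    and "\<And>a. a \<in> peirce_0 e \<Longrightarrow> (\<forall>t \<in> peirce_0 e. t * a = 0) \<Longrightarrow> a = 0"
    and "\<And>a. a \<in> peirce_half e \<Longrightarrow> (\<forall>t \<in> peirce_0 e. t * a = 0) \<Longrightarrow> a = 0"
    and "multiplicative_derivation n d"
  shows "\<forall>a b. d (a + b) = d a + d b"
proof -
  interpret peirce_derivation e n d
  proof
    fix x :: 'a
    assume "x + x = 0"
    then have "(\<Sum>i<2::nat. x) = 0" by (simp add: numeral_2_eq_2)
    with assms(2) show "x = 0" by (simp add: torsion_free_def)
  next
    show "e * e = e" using assms(4) by (simp add: nontrivial_idempotent_def)
  qed (use assms(1,8) assms(5)[of "peirce_1 e"] assms(5)[of "peirce_0 e"] assms(6,7) in simp_all)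
  show ?thesis using d_add by blast
qed

end
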